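(* Assume $\mathbf{v}^{\mathrm p}=\mathbf{0}$ on $\Gamma^v$. For $i=1,2$, let $\{\mathbf{v}_i,p_i\}$ be the solution of the Darcy–Brinkman equations for the prescribed data $\{\mathbf{b}_i,\mathbf{t}^{\mathrm p}_i\}$, i.e., with $\mathbf{D}_i=\frac12(\mathrm{grad}[\mathbf{v}_i]+\mathrm{grad}[\mathbf{v}_i]^{\mathrm T})$ and $\mathbf{T}_i=-p_i\mathbf{I}+2\mu\mathbf{D}_i$, $$\alpha\mathbf{v}_i+\mathrm{grad}[p_i]-\mathrm{div}[2\mu\mathbf{D}_i]=\rho\mathbf{b}_i\ \text{ in }\Omega,\qquad \mathrm{div}[\mathbf{v}_i]=0\ \text{ in }\Omega,\qquad \mathbf{v}_i=\mathbf{0}\ \text{ on }\Gamma^v,\qquad \mathbf{T}_i\widehat{\mathbf{n}}=\mathbf{t}^{\mathrm p}_i\ \text{ on }\Gamma^t .$$ Then $$\int_\Omega\rho\,\mathbf{b}_1\cdot\mathbf{v}_2\,\mathrm{d}\Omega+\int_{\Gamma^t}\mathbf{t}^{\mathrm p}_1\cdot\mathbf{v}_2\,\mathrm{d}\Gamma=\int_\Omega\rho\,\mathbf{b}_2\cdot\mathbf{v}_1\,\mathrm{d}\Omega+\int_{\Gamma^t}\mathbf{t}^{\mathrm p}_2\cdot\mathbf{v}_1\,\mathrm{d}\Gamma .$$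
   Context: $\Omega\subset\mathbb{R}^{nd}$ is a bounded open domain ($nd$ is the number of spatial dimensions) with piecewise smooth boundary $\partial\Omega=\overline\Omega\setminus\Omega$ and unit outward normal $\widehat{\mathbf{n}}$. The boundary is split as $\partial\Omega=\Gamma^v\cup\Gamma^t$ with $\Gamma^v\cap\Gamma^t=\emptyset$; velocity $\mathbf{v}^{\mathrm p}$ is prescribed on $\Gamma^v$ and traction on $\Gamma^t$. The drag coefficient $\alpha:\Omega\to\mathbb{R}$, $\alpha(\mathbf{x})>0$, the viscosity $\mu>0$ and the fluid density $\rho$ are the same for both problems; $\mathbf{b}_i:\Omega\to\mathbb{R}^{nd}$ are specific body forces and $\mathbf{t}^{\mathrm p}_i$ are prescribed tractions on $\Gamma^t$. $\mathbf{I}$ is the identity tensor; $\mathrm{div}$ of a tensor field is taken row-wise. All data and fields are assumed sufficiently smooth up to the boundary that the equations hold pointwise, the integrals are finite and the divergence theorem (integration by parts) applies. *)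

theory Defs
  imports "HOL-Analysis.Analysis"
begin

section \<open>Surface measure\<close>

text \<open>The \<open>d\<close>-dimensional Hausdorff measure, normalised so that it agrees with \<open>d\<close>-dimensional
  Lebesgue measure on \<open>d\<close>-dimensional planes. Empty covering sets contribute nothing, so that
  for \<open>d = 0\<close> (where \<open>0 ^ 0 = 1\<close>) one obtains the counting measure.\<close>

definition hausdorff_term :: "nat \<Rightarrow> 'a::metric_space set \<Rightarrow> ennreal" where
  "hausdorff_term d U =
     (if U = {} then 0 else ennreal (unit_ball_vol (real d) * (diameter U / 2) ^ d))"

definition hausdorff_covers :: "real \<Rightarrow> 'a::metric_space set \<Rightarrow> (nat \<Rightarrow> 'a set) set" where
  "hausdorff_covers \<delta> A =
     {U. A \<subseteq> (\<Union>k. U k) \<and> (\<forall>k. bounded (U k) \<and> diameter (U k) \<le> \<delta>)}"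

definition hausdorff_pre :: "nat \<Rightarrow> real \<Rightarrow> 'a::metric_space set \<Rightarrow> ennreal" where
  "hausdorff_pre d \<delta> A = (INF U\<in>hausdorff_covers \<delta> A. \<Sum>k. hausdorff_term d (U k))"

definition hausdorff_outer :: "nat \<Rightarrow> 'a::metric_space set \<Rightarrow> ennreal" where
  "hausdorff_outer d A = (SUP \<delta>\<in>{0<..}. hausdorff_pre d \<delta> A)"

definition hausdorff_measure :: "nat \<Rightarrow> 'a::metric_space measure" where
  "hausdorff_measure d =
     measure_of UNIV (lambda_system UNIV UNIV (hausdorff_outer d)) (hausdorff_outer d)"

definition surface_measure :: "(real^'n) measure" where
  "surface_measure = hausdorff_measure (CARD('n) - 1)"

lemma hausdorff_term_empty [simp]: "hausdorff_term d {} = 0"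
  by (simp add: hausdorff_term_def)

lemma hausdorff_pre_empty:
  assumes "\<delta> > 0" shows "hausdorff_pre d \<delta> ({} :: 'a::metric_space set) = 0"
proof -
  have "(\<lambda>_. {}) \<in> hausdorff_covers \<delta> ({} :: 'a set)"
    using assms by (simp add: hausdorff_covers_def)
  then have "hausdorff_pre d \<delta> ({} :: 'a set) \<le> (\<Sum>k. hausdorff_term d ({} :: 'a set))"
    unfolding hausdorff_pre_def by (rule INF_lower2) simp
  then show ?thesis by simp
qed

lemma hausdorff_pre_mono: "A \<subseteq> B \<Longrightarrow> hausdorff_pre d \<delta> A \<le> hausdorff_pre d \<delta> B"
  unfolding hausdorff_pre_def by (rule INF_superset_mono) (auto simp: hausdorff_covers_def)

lemma hausdorff_pre_antimono: "\<delta> \<le> \<epsilon> \<Longrightarrow> hausdorff_pre d \<epsilon> A \<le> hausdorff_pre d \<delta> A"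
  unfolding hausdorff_pre_def
  by (rule INF_superset_mono) (auto simp: hausdorff_covers_def intro: order_trans)

lemma hausdorff_outer_mono: "A \<subseteq> B \<Longrightarrow> hausdorff_outer d A \<le> hausdorff_outer d B"
  unfolding hausdorff_outer_def by (rule SUP_mono) (auto intro: hausdorff_pre_mono)

lemma hausdorff_outer_empty [simp]: "hausdorff_outer d {} = 0"
  unfolding hausdorff_outer_def by (simp add: hausdorff_pre_empty)

lemma hausdorff_pre_UN:
  "hausdorff_pre d \<delta> (\<Union>i. A i) \<le> (\<Sum>i. hausdorff_pre d \<delta> (A i :: 'a::metric_space set))"
proof (rule ennreal_le_epsilon)
  fix e :: real assume e: "0 < e" and fin: "(\<Sum>i. hausdorff_pre d \<delta> (A i)) < top"
  have "\<exists>U\<in>hausdorff_covers \<delta> (A i).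
          (\<Sum>k. hausdorff_term d (U k)) < hausdorff_pre d \<delta> (A i) + ennreal (e * (1/2)^Suc i)" for i
  proof -
    have "hausdorff_pre d \<delta> (A i) < top"
      using fin by (rule ennreal_suminf_lessD)
    then have "hausdorff_pre d \<delta> (A i) < hausdorff_pre d \<delta> (A i) + ennreal (e * (1/2)^Suc i)"
      using e by (simp add: ennreal_add_left_cancel_less[of _ 0, simplified])
    then show ?thesis
      by (subst (asm) (1) hausdorff_pre_def) (simp only: INF_less_iff)
  qed
  then obtain U where U: "\<And>i. U i \<in> hausdorff_covers \<delta> (A i)"
    and le: "\<And>i. (\<Sum>k. hausdorff_term d (U i k)) < hausdorff_pre d \<delta> (A i) + ennreal (e * (1/2)^Suc i)"
    by metis
  define V where "V n = (case prod_decode n of (i, k) \<Rightarrow> U i k)" for n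
  have "V \<in> hausdorff_covers \<delta> (\<Union>i. A i)"
  proof -
    have "x \<in> (\<Union>n. V n)" if x: "x \<in> A i" for x i
    proof -
      have "A i \<subseteq> (\<Union>k. U i k)"
        using U[of i] by (simp add: hausdorff_covers_def)
      then obtain k where "x \<in> U i k" using x by blast
      then have "x \<in> V (prod_encode (i, k))" by (simp add: V_def)
      then show ?thesis by blast
    qed
    moreover have "bounded (V n) \<and> diameter (V n) \<le> \<delta>" for n
      using U by (auto simp: V_def hausdorff_covers_def split: prod.split)
    ultimately show ?thesis by (auto simp: hausdorff_covers_def)
  qed
  then have "hausdorff_pre d \<delta> (\<Union>i. A i) \<le> (\<Sum>n. hausdorff_term d (V n))"
    unfolding hausdorff_pre_def by (rule INF_lower)
  also have "\<dots> = (\<Sum>i. \<Sum>k. hausdorff_term d (U i k))"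
    using suminf_ennreal_2dimen[where f = "\<lambda>(i, k). hausdorff_term d (U i k)", OF refl]
    by (simp add: V_def o_def prod.case_distrib[of "hausdorff_term d"])
  also have "\<dots> \<le> (\<Sum>i. hausdorff_pre d \<delta> (A i) + ennreal (e * (1/2)^Suc i))"
    using le by (intro suminf_le) (auto intro: less_imp_le)
  also have "\<dots> = (\<Sum>i. hausdorff_pre d \<delta> (A i)) + (\<Sum>i. ennreal (e * (1/2)^Suc i))"
    by (rule suminf_add[symmetric]) auto
  also have "(\<Sum>i. ennreal (e * (1/2)^Suc i)) = ennreal e"
    using sums_mult[OF power_half_series, of e] e
    by (intro suminf_ennreal_eq) auto
  finally show "hausdorff_pre d \<delta> (\<Union>i. A i) \<le> (\<Sum>i. hausdorff_pre d \<delta> (A i)) + ennreal e" .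
qed

lemma hausdorff_outer_UN:
  "hausdorff_outer d (\<Union>i. A i) \<le> (\<Sum>i. hausdorff_outer d (A i :: 'a::metric_space set))"
proof -
  have "hausdorff_pre d \<delta> (\<Union>i. A i) \<le> (\<Sum>i. hausdorff_outer d (A i))" if "\<delta> > 0" for \<delta>
    using that by (intro order_trans[OF hausdorff_pre_UN] suminf_le)
      (auto simp: hausdorff_outer_def intro: SUP_upper)
  then show ?thesis by (subst (1) hausdorff_outer_def) (auto intro: SUP_least)
qed

lemma outer_measure_space_hausdorff: "outer_measure_space UNIV (hausdorff_outer d)"
  by (auto simp: outer_measure_space_def positive_def increasing_def countably_subadditive_def
      intro: hausdorff_outer_mono hausdorff_outer_UN)

lemma measure_space_hausdorff:
  "measure_space UNIV (lambda_system UNIV UNIV (hausdorff_outer d)) (hausdorff_outer d)"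
  using sigma_algebra.caratheodory_lemma[OF sigma_algebra_Pow, of UNIV "hausdorff_outer d"]
  by (simp add: outer_measure_space_hausdorff)

lemma space_hausdorff_measure [simp]: "space (hausdorff_measure d) = UNIV"
  by (simp add: hausdorff_measure_def space_measure_of_conv)

lemma sets_hausdorff_measure:
  "sets (hausdorff_measure d :: 'a::metric_space measure) = lambda_system UNIV UNIV (hausdorff_outer d)"
proof -
  interpret sigma_algebra UNIV "lambda_system UNIV UNIV (hausdorff_outer d :: 'a set \<Rightarrow> ennreal)"
    using measure_space_hausdorff[where 'a = 'a, of d] by (simp add: measure_space_def)
  show ?thesis by (simp add: hausdorff_measure_def)
qed

lemma emeasure_hausdorff_measure:
  assumes "A \<in> sets (hausdorff_measure d)"
  shows "emeasure (hausdorff_measure d) A = hausdorff_outer d A"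
  using measure_space_hausdorff[of d] assms
  by (intro emeasure_measure_of[OF hausdorff_measure_def])
     (auto simp: measure_space_def sets_hausdorff_measure)

lemma hausdorff_outer_Un: "hausdorff_outer d (A \<union> B) \<le> hausdorff_outer d A + hausdorff_outer d B"
proof -
  have "subadditive UNIV (hausdorff_outer d :: 'a set \<Rightarrow> ennreal)"
  proof (rule ring_of_sets.countably_subadditive_subadditive)
    show "ring_of_sets UNIV (UNIV :: 'a set set)"
      by (metis Pow_UNIV ring_of_sets_Pow)
  qed (use outer_measure_space_hausdorff[of d] in \<open>auto simp: outer_measure_space_def\<close>)
  then have *: "hausdorff_outer d (A \<union> (B - A)) \<le> hausdorff_outer d A + hausdorff_outer d (B - A)"
    unfolding subadditive_def by (metis Diff_disjoint UNIV_I)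
  have "hausdorff_outer d (A \<union> B) \<le> hausdorff_outer d A + hausdorff_outer d (B - A)"
    using * by simp
  also have "\<dots> \<le> hausdorff_outer d A + hausdorff_outer d B"
    by (intro add_left_mono hausdorff_outer_mono) auto
  finally show ?thesis .
qed

lemma hausdorff_outer_separated:
  assumes r: "r > 0" and sep: "\<And>x y. x \<in> A \<Longrightarrow> y \<in> B \<Longrightarrow> r \<le> dist x y"
  shows "hausdorff_outer d A + hausdorff_outer d B \<le> hausdorff_outer d (A \<union> B)"
proof -
  have pre: "hausdorff_pre d \<delta> A + hausdorff_pre d \<delta> B \<le> hausdorff_pre d \<delta> (A \<union> B)"
    if \<delta>: "0 < \<delta>" "\<delta> < r" for \<delta>
    unfolding hausdorff_pre_def[of _ _ "A \<union> B"]
  proof (rule INF_greatest)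
    fix U assume U: "U \<in> hausdorff_covers \<delta> (A \<union> B)"
    define V where "V S k = (if U k \<inter> S = {} then {} else U k)" for S k
    have V: "hausdorff_pre d \<delta> S \<le> (\<Sum>k. hausdorff_term d (V S k))" if "S \<subseteq> A \<union> B" for S
      unfolding hausdorff_pre_def
    proof (rule INF_lower)
      show "V S \<in> hausdorff_covers \<delta> S"
        using U that \<delta> by (fastforce simp: V_def hausdorff_covers_def)
    qed
    have "hausdorff_term d (V A k) + hausdorff_term d (V B k) \<le> hausdorff_term d (U k)" for k
    proof (cases "U k \<inter> A = {} \<or> U k \<inter> B = {}")
      case False
      then obtain x y where "x \<in> U k" "y \<in> U k" "x \<in> A" "y \<in> B" by blast
      with sep have "r \<le> dist x y" by blast
      also have "\<dots> \<le> diameter (U k)"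
        using U \<open>x \<in> U k\<close> \<open>y \<in> U k\<close> by (intro diameter_bounded_bound) (auto simp: hausdorff_covers_def)
      also have "\<dots> \<le> \<delta>" using U by (auto simp: hausdorff_covers_def)
      finally show ?thesis using \<delta> by simp
    qed (auto simp: V_def)
    then have "(\<Sum>k. hausdorff_term d (V A k) + hausdorff_term d (V B k)) \<le> (\<Sum>k. hausdorff_term d (U k))"
      by (intro suminf_le) auto
    then have "(\<Sum>k. hausdorff_term d (V A k)) + (\<Sum>k. hausdorff_term d (V B k))
        \<le> (\<Sum>k. hausdorff_term d (U k))"
      by (simp add: suminf_add)
    with V[of A] V[of B] show "hausdorff_pre d \<delta> A + hausdorff_pre d \<delta> B \<le> (\<Sum>k. hausdorff_term d (U k))"
      by (meson Un_upper1 Un_upper2 add_mono order_trans)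
  qed
  have "hausdorff_outer d A + hausdorff_outer d B
      = (SUP \<delta>\<in>{0<..}. hausdorff_pre d \<delta> A + hausdorff_pre d \<delta> B)"
    unfolding hausdorff_outer_def
  proof (rule SUP_add_directed_ennreal[symmetric])
    fix i j :: real assume "i \<in> {0<..}" "j \<in> {0<..}"
    then show "\<exists>k\<in>{0<..}. hausdorff_pre d i A + hausdorff_pre d j B
        \<le> hausdorff_pre d k A + hausdorff_pre d k B"
      by (intro bexI[of _ "min i j"] add_mono hausdorff_pre_antimono) auto
  qed
  also have "\<dots> \<le> hausdorff_outer d (A \<union> B)"
  proof (rule SUP_least)
    fix \<delta> :: real assume "\<delta> \<in> {0<..}"
    define \<epsilon> where "\<epsilon> = min \<delta> (r/2)"
    have \<epsilon>: "0 < \<epsilon>" "\<epsilon> < r" "\<epsilon> \<le> \<delta>" using \<open>\<delta> \<in> _\<close> r by (auto simp: \<epsilon>_def)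
    have "hausdorff_pre d \<delta> A + hausdorff_pre d \<delta> B \<le> hausdorff_pre d \<epsilon> A + hausdorff_pre d \<epsilon> B"
      using \<epsilon> by (intro add_mono hausdorff_pre_antimono)
    also have "\<dots> \<le> hausdorff_pre d \<epsilon> (A \<union> B)" using pre \<epsilon> by blast
    also have "\<dots> \<le> hausdorff_outer d (A \<union> B)"
      unfolding hausdorff_outer_def using \<epsilon> by (intro SUP_upper) auto
    finally show "hausdorff_pre d \<delta> A + hausdorff_pre d \<delta> B \<le> hausdorff_outer d (A \<union> B)" .
  qed
  finally show ?thesis .
qed

lemma closed_sets_hausdorff_measure:
  fixes C :: "'a::metric_space set"
  assumes C: "closed C" shows "C \<in> sets (hausdorff_measure d)"
proof -
  let ?H = "hausdorff_outer d :: 'a set \<Rightarrow> ennreal"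
  have "?H (X \<inter> C) + ?H (X - C) \<le> ?H X" for X
  proof (cases "C = {} \<or> ?H X = top")
    case True then show ?thesis by auto
  next
    case False
    then have ne: "C \<noteq> {}" and fin: "?H X < top" by (auto simp: less_top)
    define r where "r n = 1 / real (Suc n)" for n
    have rpos: "0 < r n" for n by (simp add: r_def)
    have r_mono: "r n \<le> r m" if "m \<le> n" for m n using that by (simp add: r_def frac_le)
    define Y where "Y n = {x\<in>X. r n \<le> infdist x C}" for n
    define R where "R n = Y (Suc n) - Y n" for n
    have Y_sub: "Y n \<subseteq> X" for n by (auto simp: Y_def)
    have Y_mono: "Y m \<subseteq> Y n" if "m \<le> n" for m n
      using r_mono[OF that] by (auto simp: Y_def)
    have R_sep: "?H (A \<union> R (Suc (Suc n))) \<ge> ?H A + ?H (R (Suc (Suc n)))" if "A \<subseteq> Y (Suc n)" for A n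
    proof (rule hausdorff_outer_separated[of "r (Suc n) - r (Suc (Suc n))"])
      show "0 < r (Suc n) - r (Suc (Suc n))" by (simp add: r_def frac_less2)
      fix x y assume "x \<in> A" "y \<in> R (Suc (Suc n))"
      then have "r (Suc n) \<le> infdist x C" "infdist y C < r (Suc (Suc n))"
        using that by (auto simp: Y_def R_def)
      moreover have "infdist x C \<le> infdist y C + dist x y" by (rule infdist_triangle)
      ultimately show "r (Suc n) - r (Suc (Suc n)) \<le> dist x y" by linarith
    qed
    have R_sub: "R n \<subseteq> Y (Suc n)" for n by (auto simp: R_def)
    have sum_le: "(\<Sum>k<n. ?H (R (2 * k + c))) \<le> ?H X" for n c
    proof -
      have "(\<Sum>k<n. ?H (R (2 * k + c))) \<le> ?H (\<Union>k<n. R (2 * k + c))"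
      proof (induction n)
        case (Suc n)
        show ?case
        proof (cases n)
          case 0 then show ?thesis by (simp add: lessThan_Suc)
        next
          case (Suc m)
          have "(\<Union>k<n. R (2 * k + c)) \<subseteq> Y (Suc (2 * m + c))"
          proof
            fix x assume "x \<in> (\<Union>k<n. R (2 * k + c))"
            then obtain k where "k \<le> m" "x \<in> R (2 * k + c)" using Suc by (metis UN_E lessThan_iff less_Suc_eq_le)
            then show "x \<in> Y (Suc (2 * m + c))"
              using R_sub[of "2 * k + c"] Y_mono[of "Suc (2 * k + c)" "Suc (2 * m + c)"] by auto
          qed
          from R_sep[OF this] have *: "?H (\<Union>k<n. R (2 * k + c)) + ?H (R (2 * n + c))
              \<le> ?H ((\<Union>k<n. R (2 * k + c)) \<union> R (2 * n + c))"
            using Suc by simp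
          have "(\<Sum>k<Suc n. ?H (R (2 * k + c))) \<le> ?H (\<Union>k<n. R (2 * k + c)) + ?H (R (2 * n + c))"
            using Suc.IH by (simp add: add_right_mono)
          also note *
          finally show ?thesis by (simp add: lessThan_Suc Un_commute)
        qed
      qed simp
      also have "\<dots> \<le> ?H X"
        using R_sub Y_sub by (intro hausdorff_outer_mono) blast
      finally show ?thesis .
    qed
    have summ: "(\<Sum>k. ?H (R k)) < top"
    proof -
      have sub: "(\<Sum>k<2 * n. ?H (R k)) = (\<Sum>k<n. ?H (R (2 * k + 0))) + (\<Sum>k<n. ?H (R (2 * k + 1)))" for n
        by (induction n) (auto simp: add_ac)
      have "(\<Sum>k<n. ?H (R k)) \<le> ?H X + ?H X" for n
      proof -
        have "(\<Sum>k<n. ?H (R k)) \<le> (\<Sum>k<2 * n. ?H (R k))" by (intro sum_mono2) auto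
        also have "\<dots> \<le> ?H X + ?H X" unfolding sub by (intro add_mono sum_le)
        finally show ?thesis .
      qed
      then have "(\<Sum>k. ?H (R k)) \<le> ?H X + ?H X" by (intro suminf_le_const) auto
      also have "\<dots> < top" using fin by simp
      finally show ?thesis .
    qed
    have dec: "X - C \<subseteq> Y n \<union> (\<Union>k. R (k + n))" for n
    proof
      fix x assume x: "x \<in> X - C"
      then have "0 < infdist x C" using C ne by (simp add: infdist_pos_not_in_closed)
      then obtain m where "r m < infdist x C" unfolding r_def using nat_approx_posE by blast
      then have ex: "\<exists>m. x \<in> Y m" using x by (auto simp: Y_def intro!: exI[of _ m])
      define l where "l = (LEAST m. x \<in> Y m)"
      have l: "x \<in> Y l" unfolding l_def using ex by (rule LeastI_ex)
      show "x \<in> Y n \<union> (\<Union>k. R (k + n))"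
      proof (cases "l \<le> n")
        case True then show ?thesis using l Y_mono by blast
      next
        case False
        then have "x \<notin> Y (l - 1)" unfolding l_def by (intro not_less_Least) simp
        then have "x \<in> R (l - 1)" using l False by (simp add: R_def)
        then have "x \<in> R ((l - 1 - n) + n)" using False by simp
        then show ?thesis by blast
      qed
    qed
    have bound: "?H (X \<inter> C) + ?H (X - C) \<le> ?H X + (\<Sum>k. ?H (R (k + n)))" for n
    proof -
      have sep: "?H (X \<inter> C) + ?H (Y n) \<le> ?H ((X \<inter> C) \<union> Y n)"
      proof (rule hausdorff_outer_separated[OF rpos[of n]])
        fix x y assume "x \<in> X \<inter> C" "y \<in> Y n"
        then show "r n \<le> dist x y"
          using infdist_le[of x C y] by (auto simp: Y_def dist_commute)
      qed
      have "?H (X - C) \<le> ?H (Y n) + ?H (\<Union>k. R (k + n))"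
        using dec[of n] by (rule order_trans[OF hausdorff_outer_mono hausdorff_outer_Un])
      also have "\<dots> \<le> ?H (Y n) + (\<Sum>k. ?H (R (k + n)))"
        by (intro add_left_mono hausdorff_outer_UN)
      finally have "?H (X \<inter> C) + ?H (X - C) \<le> (?H (X \<inter> C) + ?H (Y n)) + (\<Sum>k. ?H (R (k + n)))"
        by (simp add: add.assoc add_left_mono)
      also have "\<dots> \<le> ?H X + (\<Sum>k. ?H (R (k + n)))"
        using Y_sub[of n] by (intro add_right_mono order_trans[OF sep] hausdorff_outer_mono) auto
      finally show ?thesis .
    qed
    have tail: "(\<lambda>n. \<Sum>k. ?H (R (k + n))) \<longlonglongrightarrow> 0"
    proof -
      define h where "h k = enn2real (?H (R k))" for k
      have lt: "?H (R k) < top" for k using summ by (rule ennreal_suminf_lessD)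
      have h: "?H (R k) = ennreal (h k)" and h0: "0 \<le> h k" for k
        using lt[of k] by (auto simp: h_def)
      have sh: "summable h"
        using summ h0 unfolding h by (intro summable_suminf_not_top) auto
      have "(\<lambda>n. \<Sum>k. h (k + n)) \<longlonglongrightarrow> 0"
        using sh by (rule suminf_exist_split2)
      then have "(\<lambda>n. ennreal (\<Sum>k. h (k + n))) \<longlonglongrightarrow> ennreal 0" by (rule tendsto_ennrealI)
      moreover have "(\<Sum>k. ?H (R (k + n))) = ennreal (\<Sum>k. h (k + n))" for n
        unfolding h using sh h0 by (intro suminf_ennreal2) (auto simp: summable_iff_shift)
      ultimately show ?thesis by simp
    qed
    have "(\<lambda>n. ?H X + (\<Sum>k. ?H (R (k + n)))) \<longlonglongrightarrow> ?H X + 0"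
      by (intro tendsto_add tendsto_const tail)
    then show ?thesis
      using bound by (intro LIMSEQ_le_const) auto
  qed
  moreover have "?H X \<le> ?H (X \<inter> C) + ?H (X - C)" for X
    using hausdorff_outer_Un[of d "X \<inter> C" "X - C"] by (simp add: Int_Diff_Un)
  ultimately have "?H (C \<inter> X) + ?H ((UNIV - C) \<inter> X) = ?H X" for X
    by (metis Diff_eq Int_commute antisym Compl_eq_Diff_UNIV)
  then show ?thesis
    by (simp add: sets_hausdorff_measure lambda_system_def)
qed

lemma borel_sets_hausdorff_measure:
  "A \<in> sets borel \<Longrightarrow> A \<in> sets (hausdorff_measure d)"
proof -
  have "sets borel \<subseteq> sets (hausdorff_measure d :: 'a measure)"
    unfolding borel_eq_closed
    using sets.sigma_sets_subset[of "Collect closed" "hausdorff_measure d :: 'a measure"]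
    by (simp add: sets_measure_of_conv) (auto intro: closed_sets_hausdorff_measure)
  then show "A \<in> sets borel \<Longrightarrow> A \<in> sets (hausdorff_measure d)" by blast
qed

section \<open>Outward normal and piecewise smooth boundaries\<close>

text \<open>Near \<open>x\<close> the set is a strict sublevel set of a \<open>C\<^sup>1\<close> function with non-vanishing gradient,
  so it lies on one side of a hypersurface there, and the normalised gradient points outwards.\<close>

definition outward_normal_at :: "(real^'n) set \<Rightarrow> real^'n \<Rightarrow> real^'n \<Rightarrow> bool" where
  "outward_normal_at \<Omega> x n \<longleftrightarrow> x \<in> frontier \<Omega> \<and>
     (\<exists>U \<phi> g. open U \<and> x \<in> U \<and> continuous_on U g \<and>
        (\<forall>y\<in>U. (\<phi> has_derivative (\<lambda>h. g y \<bullet> h)) (at y) \<and> g y \<noteq> 0) \<and>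
        \<Omega> \<inter> U = {y\<in>U. \<phi> y < (0::real)} \<and>
        n = g x /\<^sub>R norm (g x))"

definition regular_boundary :: "(real^'n) set \<Rightarrow> (real^'n) set" where
  "regular_boundary \<Omega> = {x. \<exists>n. outward_normal_at \<Omega> x n}"

definition outward_normal :: "(real^'n) set \<Rightarrow> real^'n \<Rightarrow> real^'n" where
  "outward_normal \<Omega> x = (if x \<in> regular_boundary \<Omega> then THE n. outward_normal_at \<Omega> x n else 0)"

text \<open>Finitely many relatively open smooth faces whose closures fill the boundary; the remaining
  edges and corners have no surface measure.\<close>

definition piecewise_smooth_boundary :: "(real^'n) set \<Rightarrow> bool" where
  "piecewise_smooth_boundary \<Omega> \<longleftrightarrow>
     (\<exists>\<P>. finite \<P> \<and>
        (\<forall>P\<in>\<P>. connected P \<and> openin (top_of_set (frontier \<Omega>)) P \<and> P \<subseteq> regular_boundary \<Omega>) \<and>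
        frontier \<Omega> = (\<Union>P\<in>\<P>. closure P) \<and>
        frontier \<Omega> - \<Union>\<P> \<in> null_sets surface_measure) \<and>
     emeasure surface_measure (frontier \<Omega>) < \<infinity>"

lemma sublevel_frontier_zero:
  fixes \<phi> :: "'a::real_normed_vector \<Rightarrow> real"
  assumes x: "x \<in> frontier \<Omega>" and U: "open U" "x \<in> U" and eq: "\<Omega> \<inter> U = {y\<in>U. \<phi> y < 0}"
    and cont: "continuous_on U \<phi>"
  shows "\<phi> x = 0"
proof (rule antisym)
  show "\<phi> x \<le> 0"
  proof (rule ccontr)
    assume "\<not> \<phi> x \<le> 0"
    define W where "W = {y\<in>U. 0 < \<phi> y}"
    have "open W"
      using continuous_open_preimage[OF cont U(1), of "{0<..}"]
      by (simp add: W_def vimage_def Int_def)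
    moreover have "x \<in> W" using \<open>\<not> \<phi> x \<le> 0\<close> U by (simp add: W_def)
    moreover have "x \<in> closure \<Omega>" using x by (simp add: frontier_def)
    ultimately have "W \<inter> \<Omega> \<noteq> {}"
      using open_Int_closure_eq_empty[of W \<Omega>] by blast
    then obtain y where "y \<in> \<Omega> \<inter> U" "0 < \<phi> y" by (auto simp: W_def)
    then show False unfolding eq by auto
  qed
  show "0 \<le> \<phi> x"
  proof (rule ccontr)
    assume "\<not> 0 \<le> \<phi> x"
    then have "x \<in> \<Omega> \<inter> U" unfolding eq using U by simp
    moreover have "open (\<Omega> \<inter> U)"
      using continuous_open_preimage[OF cont U(1), of "{..<0}"]
      unfolding eq by (simp add: vimage_def Int_def)
    ultimately have "x \<in> interior \<Omega>" by (meson Int_lower1 interiorI)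
    then show False using x by (simp add: frontier_def)
  qed
qed

lemma has_derivative_along_line:
  fixes w :: "'a::real_inner"
  assumes "(f has_derivative (\<lambda>w. G \<bullet> w)) (at x)"
  shows "((\<lambda>t. f (x + t *\<^sub>R w)) has_real_derivative (G \<bullet> w)) (at 0)"
proof -
  have "((\<lambda>t. x + t *\<^sub>R w) has_derivative (\<lambda>t. t *\<^sub>R w)) (at 0)"
    by (auto intro!: derivative_eq_intros)
  then have "((\<lambda>t. f (x + t *\<^sub>R w)) has_derivative (\<lambda>t. G \<bullet> (t *\<^sub>R w))) (at 0)"
    using assms has_derivative_compose[of "\<lambda>t. x + t *\<^sub>R w" "\<lambda>t. t *\<^sub>R w" 0 UNIV f "\<lambda>w. G \<bullet> w"]
    by simp
  moreover have "(\<lambda>t. G \<bullet> (t *\<^sub>R w)) = (*) (G \<bullet> w)" by auto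
  ultimately show ?thesis by (simp only: has_field_derivative_def)
qed

lemma sublevel_gradients:
  fixes \<phi> \<psi> :: "'a::real_inner \<Rightarrow> real"
  assumes x: "x \<in> frontier \<Omega>"
    and U: "open U" "x \<in> U" "\<Omega> \<inter> U = {y\<in>U. \<phi> y < 0}"
    and du: "\<And>y. y \<in> U \<Longrightarrow> (\<phi> has_derivative (\<lambda>h. g y \<bullet> h)) (at y)"
    and V: "open V" "x \<in> V" "\<Omega> \<inter> V = {y\<in>V. \<psi> y < 0}"
    and dv: "\<And>y. y \<in> V \<Longrightarrow> (\<psi> has_derivative (\<lambda>h. k y \<bullet> h)) (at y)"
    and w: "g x \<bullet> w < 0"
  shows "k x \<bullet> w \<le> 0"
proof (rule ccontr)
  assume "\<not> k x \<bullet> w \<le> 0"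
  then have kw: "0 < k x \<bullet> w" by simp
  have "continuous_on U \<phi>" "continuous_on V \<psi>"
    using du dv by (meson has_derivative_continuous continuous_at_imp_continuous_on)+
  then have z: "\<phi> x = 0" "\<psi> x = 0"
    using sublevel_frontier_zero[OF x U] sublevel_frontier_zero[OF x V] by blast+
  obtain d1 where d1: "d1 > 0" "\<And>t. 0 < t \<Longrightarrow> t < d1 \<Longrightarrow> \<phi> (x + t *\<^sub>R w) < 0"
    using DERIV_neg_dec_right[OF has_derivative_along_line[OF du[OF U(2)]] w] z by auto
  obtain d2 where d2: "d2 > 0" "\<And>t. 0 < t \<Longrightarrow> t < d2 \<Longrightarrow> 0 < \<psi> (x + t *\<^sub>R w)"
    using DERIV_pos_inc_right[OF has_derivative_along_line[OF dv[OF V(2)]] kw] z by auto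
  have "((\<lambda>t. x + t *\<^sub>R w) \<longlongrightarrow> x + 0 *\<^sub>R w) (at_right 0)" by (intro tendsto_intros)
  then have "eventually (\<lambda>t. x + t *\<^sub>R w \<in> U \<inter> V) (at_right 0)"
    using U(1,2) V(1,2) by (intro topological_tendstoD) auto
  moreover have "eventually (\<lambda>t. t \<in> {0<..<min d1 d2}) (at_right 0)"
    using d1(1) d2(1) by (intro eventually_at_right_real) simp
  ultimately have "eventually (\<lambda>t::real. False) (at_right 0)"
  proof eventually_elim
    case (elim t)
    then have "\<phi> (x + t *\<^sub>R w) < 0" "0 < \<psi> (x + t *\<^sub>R w)" using d1(2) d2(2) by simp_all
    then have "x + t *\<^sub>R w \<in> \<Omega> \<inter> U" using elim unfolding U(3) by simp
    then have "x + t *\<^sub>R w \<in> \<Omega> \<inter> V" using elim by simp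
    then show False using \<open>0 < \<psi> _\<close> unfolding V(3) by simp
  qed
  then show False by simp
qed

lemma outward_normal_at_unique:
  fixes \<Omega> :: "(real^'n) set"
  assumes "outward_normal_at \<Omega> x m" "outward_normal_at \<Omega> x n"
  shows "m = n"
proof -
  obtain U \<phi> g where "x \<in> frontier \<Omega> \<and> open U \<and> x \<in> U \<and> continuous_on U g \<and>
      (\<forall>y\<in>U. (\<phi> has_derivative (\<lambda>h. g y \<bullet> h)) (at y) \<and> g y \<noteq> 0) \<and>
      \<Omega> \<inter> U = {y\<in>U. \<phi> y < (0::real)} \<and> m = g x /\<^sub>R norm (g x)"
    using assms(1) unfolding outward_normal_at_def by (elim conjE exE) (rule that, intro conjI)
  then have 1: "x \<in> frontier \<Omega>" "open U" "x \<in> U" "\<Omega> \<inter> U = {y\<in>U. \<phi> y < (0::real)}"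
    "\<And>y. y \<in> U \<Longrightarrow> (\<phi> has_derivative (\<lambda>h. g y \<bullet> h)) (at y)" "g x \<noteq> 0" "m = g x /\<^sub>R norm (g x)"
    by blast+
  obtain V \<psi> k where "open V \<and> x \<in> V \<and> continuous_on V k \<and>
      (\<forall>y\<in>V. (\<psi> has_derivative (\<lambda>h. k y \<bullet> h)) (at y) \<and> k y \<noteq> 0) \<and>
      \<Omega> \<inter> V = {y\<in>V. \<psi> y < (0::real)} \<and> n = k x /\<^sub>R norm (k x)"
    using assms(2) unfolding outward_normal_at_def by (elim conjE exE) (rule that, intro conjI)
  then have 2: "open V" "x \<in> V" "\<Omega> \<inter> V = {y\<in>V. \<psi> y < (0::real)}"
    "\<And>y. y \<in> V \<Longrightarrow> (\<psi> has_derivative (\<lambda>h. k y \<bullet> h)) (at y)" "k x \<noteq> 0" "n = k x /\<^sub>R norm (k x)"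
    by blast+
  have imp: "n \<bullet> w \<le> 0" if "m \<bullet> w < 0" for w
  proof -
    have "g x \<bullet> w < 0" using that 1(6) unfolding 1(7) by (simp add: mult_less_0_iff)
    with 1(1-5) 2(1-4) have "k x \<bullet> w \<le> 0" by (rule sublevel_gradients)
    then show ?thesis using 2(5) unfolding 2(6) by (simp add: mult_le_0_iff)
  qed
  have m: "norm m = 1" and n: "norm n = 1" using 1(6) 2(5) unfolding 1(7) 2(6) by simp_all
  have mm: "m \<bullet> m = 1" and nn: "n \<bullet> n = 1" using m n by (simp_all add: dot_square_norm)
  have le: "m \<bullet> n \<le> 1" using norm_cauchy_schwarz[of m n] m n by simp
  have "1 \<le> m \<bullet> n + e" if e: "e > 0" for e :: real
  proof -
    have "m \<bullet> (n - m - e *\<^sub>R m) < 0"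
      using e le mm by (simp add: inner_diff_right)
    then have "n \<bullet> (n - m - e *\<^sub>R m) \<le> 0" by (rule imp)
    then have "1 \<le> m \<bullet> n + e * (m \<bullet> n)"
      using nn by (simp add: inner_diff_right inner_commute[of n m])
    also have "\<dots> \<le> m \<bullet> n + e" using le e by simp
    finally show ?thesis .
  qed
  then have "m \<bullet> n = 1" using le by (meson antisym field_le_epsilon)
  then have "(m - n) \<bullet> (m - n) = 0"
    using mm nn by (simp add: inner_diff_left inner_diff_right inner_commute[of n m])
  then show ?thesis by simp
qed

lemma outward_normal_eq: "outward_normal_at \<Omega> x n \<Longrightarrow> outward_normal \<Omega> x = n"
  using outward_normal_at_unique
  by (auto simp: outward_normal_def regular_boundary_def intro!: the_equality)

section \<open>Differential operators with boundary values\<close>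

text \<open>The \<open>j\<close>-th partial derivative in \<open>\<Omega>\<close>; at boundary points it is the limit from inside \<open>\<Omega>\<close>.\<close>

definition partial :: "(real^'n) set \<Rightarrow> 'n \<Rightarrow> (real^'n \<Rightarrow> 'b::real_normed_vector) \<Rightarrow> real^'n \<Rightarrow> 'b" where
  "partial \<Omega> j f x =
     (if x \<in> \<Omega> then frechet_derivative f (at x) (axis j 1)
      else Lim (at x within \<Omega>) (\<lambda>y. frechet_derivative f (at y) (axis j 1)))"

text \<open>\<open>C\<^sup>k\<close> up to the boundary: all partial derivatives of order at most \<open>k\<close> extend continuously
  to the closure.\<close>

primrec C_closure :: "nat \<Rightarrow> (real^'n) set \<Rightarrow> (real^'n \<Rightarrow> 'b::real_normed_vector) \<Rightarrow> bool" where
  "C_closure 0 \<Omega> f \<longleftrightarrow> continuous_on (closure \<Omega>) f"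
| "C_closure (Suc k) \<Omega> f \<longleftrightarrow> continuous_on (closure \<Omega>) f \<and>
     (\<forall>x\<in>\<Omega>. f differentiable (at x)) \<and> (\<forall>j. C_closure k \<Omega> (partial \<Omega> j f))"

definition grad :: "(real^'n) set \<Rightarrow> (real^'n \<Rightarrow> real) \<Rightarrow> real^'n \<Rightarrow> real^'n" where
  "grad \<Omega> p x = (\<chi> j. partial \<Omega> j p x)"

definition grad_vec :: "(real^'n) set \<Rightarrow> (real^'n \<Rightarrow> real^'n) \<Rightarrow> real^'n \<Rightarrow> real^'n^'n" where
  "grad_vec \<Omega> v x = (\<chi> i j. partial \<Omega> j (\<lambda>y. v y $ i) x)"

definition div_vec :: "(real^'n) set \<Rightarrow> (real^'n \<Rightarrow> real^'n) \<Rightarrow> real^'n \<Rightarrow> real" where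
  "div_vec \<Omega> v x = (\<Sum>j\<in>UNIV. partial \<Omega> j (\<lambda>y. v y $ j) x)"

definition div_tensor :: "(real^'n) set \<Rightarrow> (real^'n \<Rightarrow> real^'n^'n) \<Rightarrow> real^'n \<Rightarrow> real^'n" where
  "div_tensor \<Omega> T x = (\<chi> i. div_vec \<Omega> (\<lambda>y. T y $ i) x)"

definition divergence_theorem_on :: "(real^'n) set \<Rightarrow> bool" where
  "divergence_theorem_on \<Omega> \<longleftrightarrow>
     (\<forall>F :: real^'n \<Rightarrow> real^'n. C_closure 1 \<Omega> F \<longrightarrow>
        (LINT x:\<Omega>|lebesgue. div_vec \<Omega> F x)
          = (LINT x:frontier \<Omega>|surface_measure. F x \<bullet> outward_normal \<Omega> x))"

section \<open>The Darcy--Brinkman equations\<close>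

definition strain_rate :: "(real^'n) set \<Rightarrow> (real^'n \<Rightarrow> real^'n) \<Rightarrow> real^'n \<Rightarrow> real^'n^'n" where
  "strain_rate \<Omega> v x = (1/2) *\<^sub>R (grad_vec \<Omega> v x + transpose (grad_vec \<Omega> v x))"

definition stress ::
  "(real^'n) set \<Rightarrow> real \<Rightarrow> (real^'n \<Rightarrow> real^'n) \<Rightarrow> (real^'n \<Rightarrow> real) \<Rightarrow> real^'n \<Rightarrow> real^'n^'n" where
  "stress \<Omega> \<mu> v p x = - p x *\<^sub>R mat 1 + (2 * \<mu>) *\<^sub>R strain_rate \<Omega> v x"

text \<open>The traction condition is imposed where the outward normal exists, i.e. off the edges and
  corners of the boundary.\<close>

definition darcy_brinkman_solution ::
  "(real^'n) set \<Rightarrow> (real^'n) set \<Rightarrow> (real^'n) set \<Rightarrow> (real^'n \<Rightarrow> real) \<Rightarrow> real \<Rightarrow> real \<Rightarrow>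
   (real^'n \<Rightarrow> real^'n) \<Rightarrow> (real^'n \<Rightarrow> real^'n) \<Rightarrow> (real^'n \<Rightarrow> real^'n) \<Rightarrow>
   (real^'n \<Rightarrow> real^'n) \<Rightarrow> (real^'n \<Rightarrow> real) \<Rightarrow> bool" where
  "darcy_brinkman_solution \<Omega> \<Gamma>v \<Gamma>t \<alpha> \<mu> \<rho> v\<^sub>p b t\<^sub>p v p \<longleftrightarrow>
     (\<forall>x\<in>\<Omega>. \<alpha> x *\<^sub>R v x + grad \<Omega> p x - div_tensor \<Omega> (\<lambda>y. (2 * \<mu>) *\<^sub>R strain_rate \<Omega> v y) x
              = \<rho> *\<^sub>R b x) \<and>
     (\<forall>x\<in>\<Omega>. div_vec \<Omega> v x = 0) \<and>
     (\<forall>x\<in>\<Gamma>v. v x = v\<^sub>p x) \<and>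
     (\<forall>x\<in>\<Gamma>t \<inter> regular_boundary \<Omega>. stress \<Omega> \<mu> v p x *v outward_normal \<Omega> x = t\<^sub>p x)"

end

theory Submission
  imports Defs
begin

text \<open>Apply the divergence theorem to the field \<open>F = T\<^sub>1\<^sup>T v\<^sub>2 - T\<^sub>2\<^sup>T v\<^sub>1\<close>, where \<open>T\<^sub>i\<close> is the stress of the
  \<open>i\<close>-th solution. In \<open>div F\<close> the drag terms and, since \<open>D\<^sub>1 : grad v\<^sub>2 = D\<^sub>1 : D\<^sub>2\<close> is symmetric in the
  two solutions, the viscous terms cancel; incompressibility removes the pressures, which leaves
  \<open>\<rho> b\<^sub>2 \<bullet> v\<^sub>1 - \<rho> b\<^sub>1 \<bullet> v\<^sub>2\<close>. The flux of \<open>F\<close> vanishes on \<open>\<Gamma>v\<close> and equals \<open>t\<^sub>1 \<bullet> v\<^sub>2 - t\<^sub>2 \<bullet> v\<^sub>1\<close> at the regular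
  points of \<open>\<Gamma>t\<close>. The remaining boundary points are a null set; completeness of the Hausdorff
  measure makes the flux measurable whatever its values there.\<close>

section \<open>Fields smooth up to the boundary\<close>

lemma C_closure_continuous_on: "C_closure k \<Omega> f \<Longrightarrow> continuous_on (closure \<Omega>) f"
  by (cases k) auto

lemma C_closure_Suc_imp: "C_closure (Suc k) \<Omega> f \<Longrightarrow> C_closure k \<Omega> f"
proof (induction k arbitrary: f)
  case 0
  then show ?case by simp
next
  case (Suc k)
  have "C_closure k \<Omega> (partial \<Omega> j f)" for j
    using Suc.prems by (intro Suc.IH) simp
  then show ?case using Suc.prems by simp
qed

text \<open>At a point of the open set \<Omega> the derivative depends only on values inside
  \<Omega>, and elsewhere \<open>partial\<close> is built from limits of such derivatives. Hence the
  equality holds as total functions.\<close>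

lemma partial_cong:
  assumes "open \<Omega>" and eq: "\<And>x. x \<in> \<Omega> \<Longrightarrow> f x = g x"
  shows "partial \<Omega> j f = partial \<Omega> j g"
proof -
  have fd: "frechet_derivative f (at y) = frechet_derivative g (at y)" if "y \<in> \<Omega>" for y
  proof -
    have "(f has_derivative D) (at y) \<longleftrightarrow> (g has_derivative D) (at y)" for D
      using assms that
      by (metis has_derivative_transform_within_open)
    then show ?thesis by (simp add: frechet_derivative_def)
  qed
  \<comment> \<open>\<open>Lim\<close> is a definite description, so it suffices that both functions
    have the same limits; the values then agree even where no limit exists.\<close>
  have "((\<lambda>y. frechet_derivative f (at y) (axis j 1)) \<longlongrightarrow> l) (at x within \<Omega>) \<longleftrightarrow>
      ((\<lambda>y. frechet_derivative g (at y) (axis j 1)) \<longlongrightarrow> l) (at x within \<Omega>)" for x l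
    using fd by (intro tendsto_cong) (auto simp: eventually_at_filter)
  then show ?thesis
    using fd by (auto simp: partial_def fun_eq_iff Topological_Spaces.Lim_def)
qed

text \<open>The derivative coincides with \<open>g\<close> inside \<Omega>, and \<open>g\<close> is
  continuous on the closure, so the limit defining the boundary value is \<open>g x\<close>.\<close>

lemma partial_eqI:
  assumes "open \<Omega>" "x \<in> closure \<Omega>" "continuous_on (closure \<Omega>) g"
    and "\<And>y. y \<in> \<Omega> \<Longrightarrow> frechet_derivative f (at y) (axis j 1) = g y"
  shows "partial \<Omega> j f x = g x"
proof (cases "x \<in> \<Omega>")
  case True
  then show ?thesis using assms by (simp add: partial_def)
next
  case False
  \<comment> \<open>A point of the closure outside \<Omega> is a limit point of \<Omega>, which
    makes the limit there unique.\<close>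
  then have nt: "\<not> trivial_limit (at x within \<Omega>)"
    using assms(2) by (simp add: trivial_limit_within closure_def)
  have "(g \<longlongrightarrow> g x) (at x within closure \<Omega>)"
    using assms(2,3) by (simp add: continuous_on_def)
  then have "(g \<longlongrightarrow> g x) (at x within \<Omega>)"
    using closure_subset by (rule tendsto_within_subset)
  then have "((\<lambda>y. frechet_derivative f (at y) (axis j 1)) \<longlongrightarrow> g x) (at x within \<Omega>)"
    by (rule Lim_transform_eventually) (auto simp: eventually_at_filter assms(4))
  then show ?thesis using nt False by (simp add: partial_def tendsto_Lim)
qed

text \<open>A case split on \<open>k\<close> suffices: continuity sees only the closure,
  differentiability only \<Omega>, and the partials are equal as functions by
  \<open>partial_cong\<close>.\<close>

lemma C_closure_cong:
  assumes "open \<Omega>" and eq: "\<And>x. x \<in> closure \<Omega> \<Longrightarrow> f x = g x"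
  shows "C_closure k \<Omega> f \<longleftrightarrow> C_closure k \<Omega> g"
proof -
  have \<Omega>: "f x = g x" if "x \<in> \<Omega>" for x
    using eq that closure_subset by blast
  have "partial \<Omega> j f = partial \<Omega> j g" for j
    using \<open>open \<Omega>\<close> \<Omega> by (rule partial_cong)
  moreover have "f differentiable (at x) \<longleftrightarrow> g differentiable (at x)" if "x \<in> \<Omega>" for x
    unfolding differentiable_def
    using assms(1) \<Omega> that by (metis has_derivative_transform_within_open)
  moreover have "continuous_on (closure \<Omega>) f \<longleftrightarrow> continuous_on (closure \<Omega>) g"
    using eq by (intro continuous_on_cong) auto
  ultimately show ?thesis by (cases k) auto
qed

text \<open>Introduction rule for the inductions below. Candidates \<open>g j\<close> for the
  partial derivatives are checked only inside \<Omega>; their continuity on the closure settles the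
  boundary values.\<close>

lemma C_closure_SucI:
  assumes "open \<Omega>" "continuous_on (closure \<Omega>) f"
    and "\<And>x. x \<in> \<Omega> \<Longrightarrow> (f has_derivative f' x) (at x)"
    and "\<And>j. C_closure k \<Omega> (g j)"
    and "\<And>x j. x \<in> \<Omega> \<Longrightarrow> f' x (axis j 1) = g j x"
  shows "C_closure (Suc k) \<Omega> f"
proof -
  have "C_closure k \<Omega> (partial \<Omega> j f)" for j
  proof -
    have "partial \<Omega> j f x = g j x" if "x \<in> closure \<Omega>" for x
      using assms(1) that C_closure_continuous_on[OF assms(4)]
    proof (rule partial_eqI)
      fix y assume "y \<in> \<Omega>"
      then show "frechet_derivative f (at y) (axis j 1) = g j y"
        using assms(3,5) by (metis frechet_derivative_at)
    qed
    then show ?thesis using C_closure_cong[OF assms(1)] assms(4) by blast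
  qed
  then show ?thesis using assms(2,3) by (auto simp: differentiable_def)
qed

lemma C_closure_has_derivative:
  assumes "C_closure (Suc k) \<Omega> f" "x \<in> \<Omega>"
  shows "(f has_derivative frechet_derivative f (at x)) (at x)"
  using assms by (simp add: frechet_derivative_works)

lemma frechet_derivative_axis:
  "x \<in> \<Omega> \<Longrightarrow> frechet_derivative f (at x) (axis j 1) = partial \<Omega> j f x"
  by (simp add: partial_def)

section \<open>Algebraic closure properties of fields smooth up to the boundary\<close>

lemma C_closure_bounded_linear:
  assumes "open \<Omega>" "bounded_linear h" "C_closure k \<Omega> f"
  shows "C_closure k \<Omega> (\<lambda>x. h (f x))"
  using assms(3)
proof (induction k arbitrary: f)
  case 0
  then show ?case
    using bounded_linear.continuous_on[OF assms(2)] by simp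
next
  case (Suc k)
  note der = Suc.prems[THEN C_closure_has_derivative]
  show ?case
  proof (rule C_closure_SucI[OF assms(1)])
    show "continuous_on (closure \<Omega>) (\<lambda>x. h (f x))"
      using C_closure_continuous_on[OF Suc.prems] by (rule bounded_linear.continuous_on[OF assms(2)])
    show "((\<lambda>x. h (f x)) has_derivative (\<lambda>w. h (frechet_derivative f (at x) w))) (at x)" if "x \<in> \<Omega>" for x
      using der[OF that] by (rule bounded_linear.has_derivative[OF assms(2)])
    show "C_closure k \<Omega> (\<lambda>x. h (partial \<Omega> j f x))" for j
      using Suc.prems by (intro Suc.IH) simp
  qed (simp add: frechet_derivative_axis)
qed

lemma C_closure_add:
  assumes "open \<Omega>" "C_closure k \<Omega> f" "C_closure k \<Omega> g"
  shows "C_closure k \<Omega> (\<lambda>x. f x + g x)"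
  using assms(2,3)
proof (induction k arbitrary: f g)
  case 0
  then show ?case by (simp add: continuous_on_add)
next
  case (Suc k)
  note der = Suc.prems[THEN C_closure_has_derivative]
  show ?case
  proof (rule C_closure_SucI[OF assms(1)])
    show "continuous_on (closure \<Omega>) (\<lambda>x. f x + g x)"
      using Suc.prems by (intro continuous_on_add C_closure_continuous_on)
    show "((\<lambda>x. f x + g x) has_derivative (\<lambda>w. frechet_derivative f (at x) w + frechet_derivative g (at x) w)) (at x)" if "x \<in> \<Omega>" for x
      using der[OF that] by (rule has_derivative_add)
    show "C_closure k \<Omega> (\<lambda>x. partial \<Omega> j f x + partial \<Omega> j g x)" for j
      using Suc.prems by (intro Suc.IH) simp_all
  qed (simp add: frechet_derivative_axis)
qed

lemma C_closure_mult:
  fixes f g :: "real^'n \<Rightarrow> 'b::real_normed_algebra"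
  assumes "open \<Omega>" "C_closure k \<Omega> f" "C_closure k \<Omega> g"
  shows "C_closure k \<Omega> (\<lambda>x. f x * g x)"
  using assms(2,3)
proof (induction k arbitrary: f g)
  case 0
  then show ?case by (simp add: continuous_on_mult)
next
  case (Suc k)
  note der = Suc.prems[THEN C_closure_has_derivative]
  show ?case
  proof (rule C_closure_SucI[OF assms(1)])
    show "continuous_on (closure \<Omega>) (\<lambda>x. f x * g x)"
      using Suc.prems by (intro continuous_on_mult C_closure_continuous_on)
    show "((\<lambda>x. f x * g x) has_derivative (\<lambda>w. f x * frechet_derivative g (at x) w + frechet_derivative f (at x) w * g x)) (at x)" if "x \<in> \<Omega>" for x
      using der[OF that] by (rule has_derivative_mult)
    \<comment> \<open>The Leibniz rule leaves one factor of each product undifferentiated. That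
      factor is lowered from order \<open>Suc k\<close> to \<open>k\<close>, so that the induction
      hypothesis, general in both factors, applies.\<close>
    show "C_closure k \<Omega> (\<lambda>x. f x * partial \<Omega> j g x + partial \<Omega> j f x * g x)" for j
      using Suc.prems C_closure_Suc_imp[OF Suc.prems(1)] C_closure_Suc_imp[OF Suc.prems(2)]
      by (intro C_closure_add[OF assms(1)] Suc.IH) simp_all
  qed (simp add: frechet_derivative_axis)
qed

lemma C_closure_sum:
  assumes "open \<Omega>" "finite I" "I \<noteq> {}" "\<And>i. i \<in> I \<Longrightarrow> C_closure k \<Omega> (f i)"
  shows "C_closure k \<Omega> (\<lambda>x. \<Sum>i\<in>I. f i x)"
  using assms(2,3,4)
\<comment> \<open>The induction starts at singletons, where the sum is one of the given
  functions.\<close>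
proof (induction rule: finite_ne_induct)
  case (insert i I)
  have "C_closure k \<Omega> (\<lambda>x. f i x + (\<Sum>i\<in>I. f i x))"
    by (rule C_closure_add[OF assms(1)]) (use insert in simp_all)
  then show ?case using insert by simp
qed simp

lemma C_closure_diff:
  assumes "open \<Omega>" "C_closure k \<Omega> f" "C_closure k \<Omega> g"
  shows "C_closure k \<Omega> (\<lambda>x. f x - g x)"
  using C_closure_add[OF assms(1,2) C_closure_bounded_linear[OF assms(1) bounded_linear_minus[OF bounded_linear_ident] assms(3)]]
  by simp

lemma C_closure_nth:
  assumes "open \<Omega>" "C_closure k \<Omega> f" shows "C_closure k \<Omega> (\<lambda>x. f x $ i)"
  using assms(1) bounded_linear_vec_nth assms(2) by (rule C_closure_bounded_linear)

text \<open>Expansion in the standard basis: each summand is a component of \<open>f\<close>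
  followed by a bounded linear map.\<close>

lemma C_closure_vecI:
  fixes f :: "real^'n \<Rightarrow> real^'m"
  assumes "open \<Omega>" "\<And>i. C_closure k \<Omega> (\<lambda>x. f x $ i)"
  shows "C_closure k \<Omega> f"
proof -
  have "C_closure k \<Omega> (\<lambda>x. \<Sum>i\<in>UNIV. (f x $ i) *\<^sub>R (axis i 1 :: real^'m))"
    using assms by (intro C_closure_sum C_closure_bounded_linear[OF _ bounded_linear_scaleR_left]) auto
  moreover have "(\<lambda>x. \<Sum>i\<in>UNIV. (f x $ i) *\<^sub>R axis i 1) = f"
    by (simp add: fun_eq_iff basis_expansion flip: scalar_mult_eq_scaleR)
  ultimately show ?thesis by (simp only:)
qed

section \<open>Smoothness of the velocity gradient, strain rate and stress\<close>

lemma C_closure_grad_vec: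
  assumes "open \<Omega>" "C_closure (Suc k) \<Omega> v"
  shows "C_closure k \<Omega> (\<lambda>x. grad_vec \<Omega> v x $ i $ j)"
  using C_closure_nth[OF assms] by (simp add: grad_vec_def)

lemma strain_rate_nth:
  "strain_rate \<Omega> v x $ i $ j = (grad_vec \<Omega> v x $ i $ j + grad_vec \<Omega> v x $ j $ i) / 2"
  by (simp add: strain_rate_def transpose_def)

lemma C_closure_strain_rate:
  assumes "open \<Omega>" "C_closure (Suc k) \<Omega> v"
  shows "C_closure k \<Omega> (\<lambda>x. strain_rate \<Omega> v x $ i $ j)"
  unfolding strain_rate_nth
  using C_closure_bounded_linear[OF assms(1) bounded_linear_divide[of 2]
      C_closure_add[OF assms(1) C_closure_grad_vec[OF assms, of i j] C_closure_grad_vec[OF assms, of j i]]]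
  by simp

lemma stress_nth:
  "stress \<Omega> \<mu> v p x $ i $ j = 2 * \<mu> * strain_rate \<Omega> v x $ i $ j - p x * (if i = j then 1 else 0)"
  by (simp add: stress_def mat_def)

lemma C_closure_stress:
  assumes "open \<Omega>" "C_closure (Suc k) \<Omega> v" "C_closure k \<Omega> p"
  shows "C_closure k \<Omega> (\<lambda>x. stress \<Omega> \<mu> v p x $ i $ j)"
  unfolding stress_nth
  by (intro C_closure_diff[OF assms(1)]
      C_closure_bounded_linear[OF assms(1) bounded_linear_mult_right]
      C_closure_bounded_linear[OF assms(1) bounded_linear_mult_left]
      C_closure_strain_rate assms)

text \<open>\<open>v x v* T x\<close> is the transpose of \<open>T x\<close> applied to
  \<open>v x\<close>; its components are finite sums of products of smooth functions.\<close>

lemma C_closure_vector_matrix_mult: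
  fixes v :: "real^'n \<Rightarrow> real^'m" and T :: "real^'n \<Rightarrow> real^'l^'m"
  assumes "open \<Omega>" "C_closure k \<Omega> v" "\<And>i j. C_closure k \<Omega> (\<lambda>x. T x $ i $ j)"
  shows "C_closure k \<Omega> (\<lambda>x. v x v* T x)"
  using assms C_closure_nth[OF assms(1,2)]
  by (intro C_closure_vecI) (auto simp: vector_matrix_mult_def intro!: C_closure_sum C_closure_mult)

section \<open>Divergence of the stress contracted with a velocity\<close>

lemma partialI:
  assumes "x \<in> \<Omega>" "(f has_derivative f') (at x)"
  shows "partial \<Omega> j f x = f' (axis j 1)"
  using assms by (simp add: partial_def flip: frechet_derivative_at)

lemma partial_add:
  assumes "x \<in> \<Omega>" "f differentiable (at x)" "g differentiable (at x)"
  shows "partial \<Omega> j (\<lambda>y. f y + g y) x = partial \<Omega> j f x + partial \<Omega> j g x"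
proof -
  obtain f' g' where "(f has_derivative f') (at x)" "(g has_derivative g') (at x)"
    using assms by (auto simp: differentiable_def)
  with partialI[OF assms(1) has_derivative_add[OF this]] show ?thesis
    using assms(1) by (simp add: partialI)
qed

lemma partial_diff:
  assumes "x \<in> \<Omega>" "f differentiable (at x)" "g differentiable (at x)"
  shows "partial \<Omega> j (\<lambda>y. f y - g y) x = partial \<Omega> j f x - partial \<Omega> j g x"
proof -
  obtain f' g' where "(f has_derivative f') (at x)" "(g has_derivative g') (at x)"
    using assms by (auto simp: differentiable_def)
  with partialI[OF assms(1) has_derivative_diff[OF this]] show ?thesis
    using assms(1) by (simp add: partialI)
qed

lemma partial_mult:
  fixes f g :: "real^'n \<Rightarrow> 'b::real_normed_algebra"
  assumes "x \<in> \<Omega>" "f differentiable (at x)" "g differentiable (at x)"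
  shows "partial \<Omega> j (\<lambda>y. f y * g y) x = f x * partial \<Omega> j g x + partial \<Omega> j f x * g x"
proof -
  obtain f' g' where "(f has_derivative f') (at x)" "(g has_derivative g') (at x)"
    using assms by (auto simp: differentiable_def)
  with partialI[OF assms(1) has_derivative_mult[OF this]] show ?thesis
    using assms(1) by (simp add: partialI)
qed

lemma partial_const: "x \<in> \<Omega> \<Longrightarrow> partial \<Omega> j (\<lambda>y. c) x = 0"
  by (simp add: partialI[OF _ has_derivative_const])

lemma partial_sum:
  assumes "x \<in> \<Omega>" "finite I" "\<And>i. i \<in> I \<Longrightarrow> f i differentiable (at x)"
  shows "partial \<Omega> j (\<lambda>y. \<Sum>i\<in>I. f i y) x = (\<Sum>i\<in>I. partial \<Omega> j (f i) x)"
  using assms(2,3)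
proof (induction rule: finite_induct)
  case (insert i I)
  then show ?case using assms(1) by (simp add: partial_add differentiable_sum)
qed (simp add: assms(1) partial_const)

section \<open>Divergence of products and of the stress\<close>

lemma div_vec_diff:
  assumes "x \<in> \<Omega>" "\<And>j. (\<lambda>y. F y $ j) differentiable (at x)" "\<And>j. (\<lambda>y. G y $ j) differentiable (at x)"
  shows "div_vec \<Omega> (\<lambda>y. F y - G y) x = div_vec \<Omega> F x - div_vec \<Omega> G x"
  using assms by (simp add: div_vec_def partial_diff sum_subtractf)

lemma div_vec_vector_matrix_mult:
  fixes v :: "real^'n \<Rightarrow> real^'n" and T :: "real^'n \<Rightarrow> real^'n^'n"
  assumes x: "x \<in> \<Omega>" and v: "\<And>i. (\<lambda>y. v y $ i) differentiable (at x)"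
    and T: "\<And>i j. (\<lambda>y. T y $ i $ j) differentiable (at x)"
  shows "div_vec \<Omega> (\<lambda>y. v y v* T y) x =
    div_tensor \<Omega> T x \<bullet> v x + (\<Sum>i\<in>UNIV. \<Sum>j\<in>UNIV. T x $ i $ j * grad_vec \<Omega> v x $ i $ j)"
proof -
  have "div_vec \<Omega> (\<lambda>y. v y v* T y) x = (\<Sum>j\<in>UNIV. \<Sum>i\<in>UNIV.
      partial \<Omega> j (\<lambda>y. T y $ i $ j) x * v x $ i + T x $ i $ j * partial \<Omega> j (\<lambda>y. v y $ i) x)"
    using x v T
    by (simp add: div_vec_def vector_matrix_mult_def partial_sum partial_mult differentiable_mult mult.commute)
  \<comment> \<open>The divergence has the column index \<open>j\<close> outside, while the row-wise
    \<open>div_tensor\<close> needs the row index \<open>i\<close> there.\<close>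
  also have "\<dots> = (\<Sum>i\<in>UNIV. \<Sum>j\<in>UNIV.
      partial \<Omega> j (\<lambda>y. T y $ i $ j) x * v x $ i + T x $ i $ j * partial \<Omega> j (\<lambda>y. v y $ i) x)"
    by (rule sum.swap)
  also have "\<dots> = div_tensor \<Omega> T x \<bullet> v x + (\<Sum>i\<in>UNIV. \<Sum>j\<in>UNIV. T x $ i $ j * grad_vec \<Omega> v x $ i $ j)"
    by (simp add: sum.distrib div_tensor_def div_vec_def grad_vec_def inner_vec_def sum_distrib_right)
  finally show ?thesis .
qed

lemma div_tensor_stress:
  assumes x: "x \<in> \<Omega>" and p: "p differentiable (at x)"
    and D: "\<And>i j. (\<lambda>y. strain_rate \<Omega> v y $ i $ j) differentiable (at x)"
  shows "div_tensor \<Omega> (stress \<Omega> \<mu> v p) x =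
    div_tensor \<Omega> (\<lambda>y. (2 * \<mu>) *\<^sub>R strain_rate \<Omega> v y) x - grad \<Omega> p x"
proof -
  \<comment> \<open>The pressure part of the stress is diagonal, so summing over \<open>j\<close>
    leaves \<open>partial \<Omega> i p\<close>, the \<open>i\<close>-th component of the
    gradient.\<close>
  have "partial \<Omega> j (\<lambda>y. stress \<Omega> \<mu> v p y $ i $ j) x =
      partial \<Omega> j (\<lambda>y. 2 * \<mu> * strain_rate \<Omega> v y $ i $ j) x - (if i = j then partial \<Omega> j p x else 0)" for i j
    using assms unfolding stress_nth
    by (simp add: partial_diff partial_const)
  then show ?thesis
    by (simp add: vec_eq_iff div_tensor_def div_vec_def grad_def sum_subtractf)
qed

text \<open>The factor 2 of the viscous stress cancels the half in the strain rate. Contraction with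
  the identity tensor leaves the trace of the gradient of \<open>w\<close>, which is its
  divergence.\<close>

lemma stress_power:
  "(\<Sum>i\<in>UNIV. \<Sum>j\<in>UNIV. stress \<Omega> \<mu> v p x $ i $ j * grad_vec \<Omega> w x $ i $ j) =
    \<mu> * (\<Sum>i\<in>UNIV. \<Sum>j\<in>UNIV. (grad_vec \<Omega> v x $ i $ j + grad_vec \<Omega> v x $ j $ i) * grad_vec \<Omega> w x $ i $ j)
    - p x * div_vec \<Omega> w x"
proof -
  have "stress \<Omega> \<mu> v p x $ i $ j * grad_vec \<Omega> w x $ i $ j =
      \<mu> * ((grad_vec \<Omega> v x $ i $ j + grad_vec \<Omega> v x $ j $ i) * grad_vec \<Omega> w x $ i $ j)
      - (if i = j then p x * grad_vec \<Omega> w x $ i $ j else 0)" for i j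
    by (simp add: stress_nth strain_rate_nth algebra_simps)
  then show ?thesis
    by (simp add: sum_subtractf div_vec_def grad_vec_def flip: sum_distrib_left)
qed

text \<open>The entrywise product is commutative, and exchanging the summation indices moves the
  transpose from \<open>A\<close> to \<open>B\<close>. This is what cancels the viscous
  terms.\<close>

lemma symmetric_gradient_product_commute:
  fixes A B :: "real^'n^'n"
  shows "(\<Sum>i\<in>UNIV. \<Sum>j\<in>UNIV. (A $ i $ j + A $ j $ i) * B $ i $ j) =
    (\<Sum>i\<in>UNIV. \<Sum>j\<in>UNIV. (B $ i $ j + B $ j $ i) * A $ i $ j)"
proof -
  have "(\<Sum>i\<in>UNIV. \<Sum>j\<in>UNIV. A $ j $ i * B $ i $ j) = (\<Sum>i\<in>UNIV. \<Sum>j\<in>UNIV. B $ j $ i * A $ i $ j)"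
    by (subst sum.swap) (simp add: mult.commute)
  then show ?thesis
    by (simp add: distrib_right sum.distrib) (simp add: mult.commute)
qed

section \<open>Completeness of the Hausdorff measure\<close>

text \<open>Caratheodory's criterion holds for every set of outer measure zero: of the two pieces of
  a test set one has outer measure zero and the other is bounded by monotonicity; subadditivity
  gives the reverse inequality.\<close>

lemma null_sets_hausdorff_measure_subset:
  assumes "N \<in> null_sets (hausdorff_measure d)" "A \<subseteq> N"
  shows "A \<in> null_sets (hausdorff_measure d)"
proof -
  have "hausdorff_outer d N = 0"
    using assms(1) emeasure_hausdorff_measure[of N d] by (auto simp: null_sets_def)
  then have A: "hausdorff_outer d A = 0"
    using hausdorff_outer_mono[OF assms(2), of d] by simp
  have "hausdorff_outer d (A \<inter> X) + hausdorff_outer d ((UNIV - A) \<inter> X) = hausdorff_outer d X" for X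
  proof (rule antisym)
    have 0: "hausdorff_outer d (A \<inter> X) = 0"
      using A hausdorff_outer_mono[of "A \<inter> X" A d] by simp
    then show "hausdorff_outer d (A \<inter> X) + hausdorff_outer d ((UNIV - A) \<inter> X) \<le> hausdorff_outer d X"
      by (simp add: hausdorff_outer_mono)
    have "X = (A \<inter> X) \<union> ((UNIV - A) \<inter> X)" by blast
    then show "hausdorff_outer d X \<le> hausdorff_outer d (A \<inter> X) + hausdorff_outer d ((UNIV - A) \<inter> X)"
      by (metis hausdorff_outer_Un)
  qed
  then have "A \<in> sets (hausdorff_measure d)"
    by (simp add: sets_hausdorff_measure lambda_system_def)
  then show ?thesis using A by (simp add: null_sets_def emeasure_hausdorff_measure)
qed

text \<open>A preimage under \<open>f\<close> splits into the part off \<open>N\<close>, where it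
  agrees with that of \<open>g\<close>, and a subset of \<open>N\<close>, measurable by
  completeness.\<close>

lemma borel_measurable_hausdorff_measure_cong:
  assumes g: "g \<in> borel_measurable (hausdorff_measure d)"
    and N: "N \<in> null_sets (hausdorff_measure d)" and eq: "\<And>x. x \<notin> N \<Longrightarrow> f x = g x"
  shows "f \<in> borel_measurable (hausdorff_measure d)"
proof (rule measurableI)
  fix S :: "'b set" assume "S \<in> sets borel"
  then have "g -` S \<inter> space (hausdorff_measure d) \<in> sets (hausdorff_measure d)"
    using g by (rule measurable_sets[rotated])
  moreover have "f -` S \<inter> N \<in> sets (hausdorff_measure d)"
    using null_sets_hausdorff_measure_subset[OF N] by blast
  moreover have "f -` S \<inter> space (hausdorff_measure d) =
      (g -` S \<inter> space (hausdorff_measure d) - N) \<union> (f -` S \<inter> N)"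
    using eq by auto
  ultimately show "f -` S \<inter> space (hausdorff_measure d) \<in> sets (hausdorff_measure d)"
    using N by (metis null_setsD2 sets.Diff sets.Un)
qed simp

section \<open>Reciprocity\<close>

text \<open>The momentum balance turns the divergence of the stress into drag minus body force, and
  incompressibility of \<open>w\<close> removes the pressure. Apart from the body force, what
  remains is symmetric in \<open>v\<close> and \<open>w\<close>.\<close>

lemma darcy_brinkman_div_flux:
  assumes "open \<Omega>" "x \<in> \<Omega>" "darcy_brinkman_solution \<Omega> \<Gamma>v \<Gamma>t \<alpha> \<mu> \<rho> v\<^sub>p b t v p"
    and "C_closure 2 \<Omega> v" "C_closure 1 \<Omega> p" "C_closure 1 \<Omega> w" "div_vec \<Omega> w x = 0"
  shows "div_vec \<Omega> (\<lambda>y. w y v* stress \<Omega> \<mu> v p y) x =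
    \<alpha> x * (v x \<bullet> w x) - \<rho> *\<^sub>R b x \<bullet> w x +
    \<mu> * (\<Sum>i\<in>UNIV. \<Sum>j\<in>UNIV. (grad_vec \<Omega> v x $ i $ j + grad_vec \<Omega> v x $ j $ i) * grad_vec \<Omega> w x $ i $ j)"
proof -
  have v: "C_closure (Suc 1) \<Omega> v"
    using assms(4) by (simp add: numeral_2_eq_2)
  have diff: "f differentiable (at x)" if "C_closure 1 \<Omega> f" for f
    using that assms(2) by simp
  have "div_tensor \<Omega> (\<lambda>y. (2 * \<mu>) *\<^sub>R strain_rate \<Omega> v y) x - grad \<Omega> p x = \<alpha> x *\<^sub>R v x - \<rho> *\<^sub>R b x"
    using assms(2,3) unfolding darcy_brinkman_solution_def by (simp add: algebra_simps)
  moreover have "div_tensor \<Omega> (stress \<Omega> \<mu> v p) x =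
      div_tensor \<Omega> (\<lambda>y. (2 * \<mu>) *\<^sub>R strain_rate \<Omega> v y) x - grad \<Omega> p x"
    using assms(2) diff[OF assms(5)] diff[OF C_closure_strain_rate[OF assms(1) v]]
    by (rule div_tensor_stress)
  moreover have "div_vec \<Omega> (\<lambda>y. w y v* stress \<Omega> \<mu> v p y) x = div_tensor \<Omega> (stress \<Omega> \<mu> v p) x \<bullet> w x +
      (\<Sum>i\<in>UNIV. \<Sum>j\<in>UNIV. stress \<Omega> \<mu> v p x $ i $ j * grad_vec \<Omega> w x $ i $ j)"
    using assms(2) diff[OF C_closure_nth[OF assms(1,6)]] diff[OF C_closure_stress[OF assms(1) v assms(5)]]
    by (rule div_vec_vector_matrix_mult)
  ultimately show ?thesis
    using assms(7) by (simp add: stress_power inner_diff_left)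
qed

theorem theorem3:
  fixes \<Omega> \<Gamma>v \<Gamma>t :: "(real^'n) set"
    and \<alpha> :: "real^'n \<Rightarrow> real" and \<mu> \<rho> :: real
    and v\<^sub>p b\<^sub>1 b\<^sub>2 t\<^sub>1 t\<^sub>2 v\<^sub>1 v\<^sub>2 :: "real^'n \<Rightarrow> real^'n"
    and p\<^sub>1 p\<^sub>2 :: "real^'n \<Rightarrow> real"
  assumes "open \<Omega>" "bounded \<Omega>" "piecewise_smooth_boundary \<Omega>" "divergence_theorem_on \<Omega>"
    and "frontier \<Omega> = \<Gamma>v \<union> \<Gamma>t" "\<Gamma>v \<inter> \<Gamma>t = {}"
    and "\<forall>x\<in>\<Omega>. \<alpha> x > 0" "\<mu> > 0"
    and "\<forall>x\<in>\<Gamma>v. v\<^sub>p x = 0"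
    and "darcy_brinkman_solution \<Omega> \<Gamma>v \<Gamma>t \<alpha> \<mu> \<rho> v\<^sub>p b\<^sub>1 t\<^sub>1 v\<^sub>1 p\<^sub>1"
    and "darcy_brinkman_solution \<Omega> \<Gamma>v \<Gamma>t \<alpha> \<mu> \<rho> v\<^sub>p b\<^sub>2 t\<^sub>2 v\<^sub>2 p\<^sub>2"
    and "C_closure 2 \<Omega> v\<^sub>1" "C_closure 1 \<Omega> p\<^sub>1"
    and "C_closure 2 \<Omega> v\<^sub>2" "C_closure 1 \<Omega> p\<^sub>2"
    and "set_integrable lebesgue \<Omega> (\<lambda>x. \<rho> *\<^sub>R b\<^sub>1 x \<bullet> v\<^sub>2 x)"
    and "set_integrable lebesgue \<Omega> (\<lambda>x. \<rho> *\<^sub>R b\<^sub>2 x \<bullet> v\<^sub>1 x)"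
    and "set_integrable surface_measure \<Gamma>t (\<lambda>x. t\<^sub>1 x \<bullet> v\<^sub>2 x)"
    and "set_integrable surface_measure \<Gamma>t (\<lambda>x. t\<^sub>2 x \<bullet> v\<^sub>1 x)"
  shows "(LINT x:\<Omega>|lebesgue. \<rho> *\<^sub>R b\<^sub>1 x \<bullet> v\<^sub>2 x) + (LINT x:\<Gamma>t|surface_measure. t\<^sub>1 x \<bullet> v\<^sub>2 x)
       = (LINT x:\<Omega>|lebesgue. \<rho> *\<^sub>R b\<^sub>2 x \<bullet> v\<^sub>1 x) + (LINT x:\<Gamma>t|surface_measure. t\<^sub>2 x \<bullet> v\<^sub>1 x)"
proof -
  let ?F = "\<lambda>x. v\<^sub>2 x v* stress \<Omega> \<mu> v\<^sub>1 p\<^sub>1 x - v\<^sub>1 x v* stress \<Omega> \<mu> v\<^sub>2 p\<^sub>2 x"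
  let ?M = "surface_measure :: (real^'n) measure"
  have C: "C_closure (Suc 1) \<Omega> v\<^sub>1" "C_closure (Suc 1) \<Omega> v\<^sub>2"
    using assms(12,14) by (simp_all add: numeral_2_eq_2)
  note C1 = C[THEN C_closure_Suc_imp]
  have CF: "C_closure 1 \<Omega> (\<lambda>x. v\<^sub>2 x v* stress \<Omega> \<mu> v\<^sub>1 p\<^sub>1 x)"
      "C_closure 1 \<Omega> (\<lambda>x. v\<^sub>1 x v* stress \<Omega> \<mu> v\<^sub>2 p\<^sub>2 x)"
    using assms(1,13,15) C C1 by (auto intro!: C_closure_vector_matrix_mult C_closure_stress simp del: C_closure.simps One_nat_def)
  have div: "div_vec \<Omega> ?F x = \<rho> *\<^sub>R b\<^sub>2 x \<bullet> v\<^sub>1 x - \<rho> *\<^sub>R b\<^sub>1 x \<bullet> v\<^sub>2 x" if x: "x \<in> \<Omega>" for x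
  proof -
    have 0: "div_vec \<Omega> v\<^sub>1 x = 0" "div_vec \<Omega> v\<^sub>2 x = 0"
      using assms(10,11) x by (auto simp: darcy_brinkman_solution_def)
    have d: "(\<lambda>y. f y $ j) differentiable (at x)" if "C_closure 1 \<Omega> f" for f :: "real^'n \<Rightarrow> real^'n" and j
      using C_closure_nth[OF assms(1) that, of j] x by simp
    \<comment> \<open>Fixing the first matrix as the gradient of \<open>v\<^sub>1\<close> makes the
      commutation rule rewrite only one of the two viscous sums; they then coincide, and
      \<open>inner_commute\<close> cancels the drag.\<close>
    show ?thesis
      unfolding div_vec_diff[OF x d[OF CF(1)] d[OF CF(2)]]
        darcy_brinkman_div_flux[OF assms(1) x assms(10,12,13) C1(2) 0(2)]
        darcy_brinkman_div_flux[OF assms(1) x assms(11,14,15) C1(1) 0(1)]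
        symmetric_gradient_product_commute[of "grad_vec \<Omega> v\<^sub>1 x"]
      by (simp add: inner_commute)
  qed
  have "(LINT x:\<Omega>|lebesgue. div_vec \<Omega> ?F x)
      = (LINT x:\<Omega>|lebesgue. \<rho> *\<^sub>R b\<^sub>2 x \<bullet> v\<^sub>1 x - \<rho> *\<^sub>R b\<^sub>1 x \<bullet> v\<^sub>2 x)"
    unfolding set_lebesgue_integral_def
    by (rule Bochner_Integration.integral_cong) (simp_all add: indicator_def div)
  also have "\<dots> = (LINT x:\<Omega>|lebesgue. \<rho> *\<^sub>R b\<^sub>2 x \<bullet> v\<^sub>1 x) - (LINT x:\<Omega>|lebesgue. \<rho> *\<^sub>R b\<^sub>1 x \<bullet> v\<^sub>2 x)"
    using assms(16,17) by (intro set_integral_diff)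
  finally have vol: "(LINT x:\<Omega>|lebesgue. div_vec \<Omega> ?F x) = \<dots>" .

  obtain \<P> where P: "\<forall>P\<in>\<P>. P \<subseteq> regular_boundary \<Omega>" "frontier \<Omega> - \<Union>\<P> \<in> null_sets ?M"
    using assms(3) unfolding piecewise_smooth_boundary_def ball_conj_distrib by (elim conjE exE) (rule that)
  \<comment> \<open>Since the faces lie in the regular boundary, \<open>?N\<close> contains every
    boundary point without a normal. Off it the traction condition is available on all of
    \<open>\<Gamma>t\<close>.\<close>
  let ?N = "frontier \<Omega> - \<Union>\<P>"
  \<comment> \<open>Indicators extend both integrands by zero, so that they can be compared on the
    whole space.\<close>
  let ?f = "\<lambda>x. indicator (frontier \<Omega>) x *\<^sub>R (?F x \<bullet> outward_normal \<Omega> x)"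
  let ?g = "\<lambda>x. indicator \<Gamma>t x *\<^sub>R (t\<^sub>1 x \<bullet> v\<^sub>2 x - t\<^sub>2 x \<bullet> v\<^sub>1 x)"
  have eq: "?f x = ?g x" if x: "x \<notin> ?N" for x
  proof -
    consider "x \<notin> frontier \<Omega>" | "x \<in> \<Gamma>v" | "x \<in> \<Gamma>t" "x \<in> regular_boundary \<Omega>"
      using x assms(5) P(1) by blast
    then show ?thesis
    proof cases
      case 1
      then show ?thesis using assms(5) by simp
    next
      case 2
      then have "v\<^sub>1 x = 0" "v\<^sub>2 x = 0"
        using assms(9-11) by (auto simp: darcy_brinkman_solution_def)
      \<comment> \<open>\<open>dot_lmul_matrix\<close> moves the stress onto the normal, so each
        flux is a velocity dotted with a traction and vanishes with the velocity, whatever value the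
        normal has at \<open>x\<close>.\<close>
      then show ?thesis by (simp add: inner_diff_left dot_lmul_matrix)
    next
      case 3
      then have "stress \<Omega> \<mu> v\<^sub>1 p\<^sub>1 x *v outward_normal \<Omega> x = t\<^sub>1 x"
          "stress \<Omega> \<mu> v\<^sub>2 p\<^sub>2 x *v outward_normal \<Omega> x = t\<^sub>2 x"
        using assms(10,11) by (auto simp: darcy_brinkman_solution_def)
      then show ?thesis
        using 3 assms(5) by (simp add: inner_diff_left dot_lmul_matrix) (simp add: inner_commute)
    qed
  qed
  have g: "set_integrable ?M \<Gamma>t (\<lambda>x. t\<^sub>1 x \<bullet> v\<^sub>2 x - t\<^sub>2 x \<bullet> v\<^sub>1 x)"
    using assms(18,19) by (rule set_integral_diff)
  then have gm: "?g \<in> borel_measurable ?M"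
    unfolding set_integrable_def by (rule borel_measurable_integrable)
  \<comment> \<open>Equality of the integrals needs measurability on both sides. That of
    \<open>?g\<close> comes from the integrable traction work; \<open>?f\<close>, which involves the
    normal, inherits it by agreeing with \<open>?g\<close> off a null set.\<close>
  have "?f \<in> borel_measurable ?M"
    using gm P(2) eq unfolding surface_measure_def by (rule borel_measurable_hausdorff_measure_cong)
  moreover have "AE x in ?M. ?f x = ?g x"
    using P(2) by (rule AE_I') (use eq in blast)
  ultimately have "(LINT x|?M. ?f x) = (LINT x|?M. ?g x)"
    using gm by (intro integral_cong_AE)
  then have "(LINT x:frontier \<Omega>|?M. ?F x \<bullet> outward_normal \<Omega> x)
      = (LINT x:\<Gamma>t|?M. t\<^sub>1 x \<bullet> v\<^sub>2 x - t\<^sub>2 x \<bullet> v\<^sub>1 x)"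
    by (simp only: set_lebesgue_integral_def)
  also have "\<dots> = (LINT x:\<Gamma>t|?M. t\<^sub>1 x \<bullet> v\<^sub>2 x) - (LINT x:\<Gamma>t|?M. t\<^sub>2 x \<bullet> v\<^sub>1 x)"
    using assms(18,19) by (intro set_integral_diff)
  finally have surf: "(LINT x:frontier \<Omega>|?M. ?F x \<bullet> outward_normal \<Omega> x) = \<dots>" .

  \<comment> \<open>The divergence theorem equates the two differences in \<open>vol\<close> and
    \<open>surf\<close>; moving the negative terms across gives the reciprocity relation.\<close>
  have "(LINT x:\<Omega>|lebesgue. div_vec \<Omega> ?F x) = (LINT x:frontier \<Omega>|?M. ?F x \<bullet> outward_normal \<Omega> x)"
    using assms(4) C_closure_diff[OF assms(1) CF] unfolding divergence_theorem_on_def by blast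
  then show ?thesis unfolding vol surf by linarith
qed

end
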